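(* Fix $\epsilon\in(0,1)$ and samples indexed by $i=1,\dots,n$. For each $i$ let $\widehat p^{s_i',\pi_Z(s_i')}$ be the (fixed, independent of $\theta$) histogram density of the target return $Y_i^k$, let $\Delta_E^i$ be the bin with $\mathbb E[Y_i^k]\in\Delta_E^i$, and let $\widehat\mu^{s_i',\pi_Z(s_i')}$ be the histogram density defined by $$\widehat p^{s_i',\pi_Z(s_i')}(x)=(1-\epsilon)\,\frac{\mathbf 1(x\in\Delta_E^i)}{\Delta}+\epsilon\,\widehat\mu^{s_i',\pi_Z(s_i')}(x),$$ where $\epsilon$ is such that $\widehat\mu^{s_i',\pi_Z(s_i')}$ is a valid density for every $i$. Let $q_\theta^{s_i,a_i}$ be the parameterized histogram density of $Z_\theta(s_i,a_i)$ on the same bins. Then, with the KL divergence as the distribution divergence, the Neural Fitted Z-Iteration update $$\operatorname*{argmin}_{q_\theta}\ \frac1n\sum_{i=1}^n D_{\mathrm{KL}}\big(\widehat p^{s_i',\pi_Z(s_i')},\,q_\theta^{s_i,a_i}\big)$$ coincides with $$\operatorname*{argmin}_{q_\theta}\ \frac1n\sum_{i=1}^n\Big[-\log q_\theta^{s_i,a_i}(\Delta_E^i)+\alpha\,\mathcal H\big(\widehat\mu^{s_i',\pi_Z(s_i')},\,q_\theta^{s_i,a_i}\big)\Big],\qquad \alpha=\frac{\epsilon}{1-\epsilon}>0 .$$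
   Context: Bins: fix $l_0\le l_1\le\dots\le l_N$ with equal bin size $\Delta>0$; $\Delta_j=[l_{j-1},l_j)$ for $j<N$ and $\Delta_N=[l_{N-1},l_N]$. A histogram density is a function $\sum_{j=1}^N p_j\mathbf 1(x\in\Delta_j)/\Delta$ with $p_j\ge0$ and $\sum_j p_j=1$. For the parameterized histogram density $q_\theta^{s,a}(x)=\sum_j q_\theta^{s,a}(\Delta_j)\mathbf 1(x\in\Delta_j)/\Delta$, the symbol $q_\theta^{s,a}(\Delta_j)$ denotes the coefficient (probability) of bin $\Delta_j$. Neural Fitted Z-Iteration (Neural FZI): given transitions $(s_i,a_i,r_i,s_i')$, the update is $Z_\theta^{k+1}=\operatorname{argmin}_{Z_\theta}\frac1n\sum_{i=1}^n d_p(Y_i^k,Z_\theta(s_i,a_i))$, where $d_p$ is a divergence between distributions and the target return $Y_i^k=\mathcal R(s_i,a_i)+\gamma Z_{\theta^*}^k(s_i',\pi_Z(s_i'))$, with $\pi_Z(s')=\operatorname{argmax}_{a'}\mathbb E[Z_{\theta^*}^k(s',a')]$, is computed from a fixed target network $\theta^*$. Here distributions are represented by histogram densities on the common bins and $d_p=D_{\mathrm{KL}}$. $D_{\mathrm{KL}}(p,q)=\int p(x)\log\frac{p(x)}{q(x)}\,dx$ and $\mathcal H(p,q)=-\int p(x)\log q(x)\,dx$ (integrals over $[l_0,l_N]$, with $0\log 0=0$ and value $+\infty$ allowed). *)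

theory Defs
  imports "HOL-Probability.Probability"
begin

text \<open>
  The bins are numbered \<open>1, \<dots>, N\<close>; a histogram is given by its bin probabilities
  \<open>p :: nat \<Rightarrow> real\<close>, of which only the values \<open>p 1, \<dots>, p N\<close> matter.
\<close>

definition equal_bins :: "(nat \<Rightarrow> real) \<Rightarrow> nat \<Rightarrow> real \<Rightarrow> bool" where
  "equal_bins l N \<Delta> \<longleftrightarrow> N \<ge> 1 \<and> \<Delta> > 0 \<and> (\<forall>j\<in>{1..N}. l j - l (j - 1) = \<Delta>)"

definition bin :: "(nat \<Rightarrow> real) \<Rightarrow> nat \<Rightarrow> nat \<Rightarrow> real set" where
  "bin l N j = (if j < N then {l (j - 1)..<l j} else {l (j - 1)..l j})"

definition hist_probs :: "nat \<Rightarrow> (nat \<Rightarrow> real) \<Rightarrow> bool" where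
  "hist_probs N p \<longleftrightarrow> (\<forall>j\<in>{1..N}. p j \<ge> 0) \<and> (\<Sum>j=1..N. p j) = 1"

definition hist_density ::
  "(nat \<Rightarrow> real) \<Rightarrow> nat \<Rightarrow> real \<Rightarrow> (nat \<Rightarrow> real) \<Rightarrow> real \<Rightarrow> real" where
  "hist_density l N \<Delta> p x = (\<Sum>j=1..N. p j * indicator (bin l N j) x / \<Delta>)"

text \<open>
  The logarithm on the extended reals, with \<open>log 0 = -\<infinity>\<close> (the real function \<open>ln\<close> has
  \<open>ln 0 = 0\<close>, which would make the divergences below finite where they have to be infinite).
\<close>

definition elog :: "ereal \<Rightarrow> ereal" where
  "elog x = (if x \<le> 0 then -\<infinity> else if x = \<infinity> then \<infinity> else ereal (ln (real_of_ereal x)))"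

text \<open>
  The Lebesgue integral of an extended-real function as the integral of its positive part minus
  that of its negative part; \<^const>\<open>e2ennreal\<close> maps negative numbers to \<open>0\<close>.
\<close>

definition ext_integral :: "real set \<Rightarrow> (real \<Rightarrow> ereal) \<Rightarrow> ereal" where
  "ext_integral A f =
     enn2ereal (\<integral>\<^sup>+x\<in>A. e2ennreal (f x) \<partial>lborel)
     - enn2ereal (\<integral>\<^sup>+x\<in>A. e2ennreal (- f x) \<partial>lborel)"

text \<open>
  Since \<open>0 * y = 0\<close> for all \<open>y :: ereal\<close> and \<open>ereal a / 0 = \<infinity>\<close> for \<open>a > 0\<close>, the integrands
  below obey \<open>0 log 0 = 0 log (0 / 0) = 0\<close> and \<open>a log (a / 0) = \<infinity>\<close> for \<open>a > 0\<close>. The library's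
  \<^const>\<open>KL_divergence\<close> is real-valued and hence of no use without absolute continuity.
\<close>

definition KL :: "real set \<Rightarrow> (real \<Rightarrow> real) \<Rightarrow> (real \<Rightarrow> real) \<Rightarrow> ereal" where
  "KL A p q = ext_integral A (\<lambda>x. ereal (p x) * elog (ereal (p x) / ereal (q x)))"

definition cross_entropy :: "real set \<Rightarrow> (real \<Rightarrow> real) \<Rightarrow> (real \<Rightarrow> real) \<Rightarrow> ereal" where
  "cross_entropy A p q = - ext_integral A (\<lambda>x. ereal (p x) * elog (ereal (q x)))"

definition argmin_set :: "('b \<Rightarrow> ereal) \<Rightarrow> 'b set \<Rightarrow> 'b set" where
  "argmin_set F S = {x. is_arg_min F (\<lambda>x. x \<in> S) x}"

text \<open>
  One update of Neural Fitted Z-Iteration for a divergence \<open>d\<close> on (representations of)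
  distributions: \<open>Y i\<close> is the representation of the \<open>i\<close>-th target return, and \<open>\<Z>\<close> is the
  class \<open>{Z\<^sub>\<theta>. \<theta> \<in> \<Theta>}\<close> over which the network ranges.
\<close>

definition neural_FZI_update ::
  "('d \<Rightarrow> 'd \<Rightarrow> ereal) \<Rightarrow> nat \<Rightarrow> (nat \<Rightarrow> 's) \<Rightarrow> (nat \<Rightarrow> 'a) \<Rightarrow> (nat \<Rightarrow> 'd)
    \<Rightarrow> ('s \<Rightarrow> 'a \<Rightarrow> 'd) set \<Rightarrow> ('s \<Rightarrow> 'a \<Rightarrow> 'd) set" where
  "neural_FZI_update d n s a Y \<Z> =
     argmin_set (\<lambda>Z. ereal (1 / real n) * (\<Sum>i=1..n. d (Y i) (Z (s i) (a i)))) \<Z>"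

end

(* The integrands are constant on each bin, so the divergences are finite sums over the bins in
   the extended reals. Inserting p_j = (1 - \<epsilon>) [j = E] + \<epsilon> \<mu>_j turns the Kullback-Leibler loss of
   a sample into 1 - \<epsilon> times the regularised loss, plus a constant; one side is infinite exactly
   when the other is. Averages therefore agree up to a strictly increasing affine map. *)

theory Submission
  imports Defs
begin

section \<open>Affine maps, minimisers and averages in the extended reals\<close>

text \<open>For \<open>c > 0\<close> and real \<open>d\<close>, the map
  \<open>u \<mapsto> c * u + d\<close> is strictly increasing on all extended reals, infinities
  included, and \<open>is_arg_min\<close> depends on strict comparisons only.\<close>

lemma argmin_set_cong_affine:
  fixes F G :: "'b \<Rightarrow> ereal"
  assumes "\<And>x. x \<in> S \<Longrightarrow> F x = ereal c * G x + ereal d" and c: "c > 0"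
  shows "argmin_set F S = argmin_set G S"
proof -
  have mono: "ereal c * u + ereal d < ereal c * v + ereal d \<longleftrightarrow> u < v" for u v
    using c by (cases u; cases v) auto
  have "F x < F y \<longleftrightarrow> G x < G y" if "x \<in> S" "y \<in> S" for x y
    using that by (simp only: assms(1) mono)
  then show ?thesis
    unfolding argmin_set_def is_arg_min_def by blast
qed

text \<open>Distributivity can fail in \<open>ereal\<close> when infinities of opposite sign meet.
  Excluding \<open>-\<infinity>\<close> leaves two clean cases: one infinite term makes both sides
  \<open>\<infinity>\<close>, otherwise all terms are real.\<close>

lemma ereal_mean_affine:
  fixes K G :: "'i \<Rightarrow> ereal"
  assumes fin: "finite I" and K: "\<And>i. i \<in> I \<Longrightarrow> K i = ereal c * G i + ereal (d i)"
    and G: "\<And>i. i \<in> I \<Longrightarrow> G i \<noteq> -\<infinity>" and c: "c > 0" and w: "w > 0"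
  shows "ereal w * sum K I = ereal c * (ereal w * sum G I) + ereal (w * sum d I)"
proof (cases "\<exists>i\<in>I. G i = \<infinity>")
  case True
  then obtain i where i: "i \<in> I" "G i = \<infinity>" by blast
  then have "K i = \<infinity>" using K[of i] c by simp
  then have "sum K I = \<infinity>" "sum G I = \<infinity>" using i fin by (auto simp: sum_Pinfty)
  then show ?thesis using c w by simp
next
  case False
  define g where "g i = real_of_ereal (G i)" for i
  have g: "G i = ereal (g i)" if "i \<in> I" for i
    using False G that by (cases "G i") (auto simp: g_def)
  have "sum G I = ereal (sum g I)" using g by (simp flip: sum_ereal)
  moreover have "sum K I = ereal (\<Sum>i\<in>I. c * g i + d i)" using g K by (simp flip: sum_ereal)
  ultimately show ?thesis
    by (simp add: sum.distrib sum_distrib_left algebra_simps)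
qed

section \<open>The bins as a partition of \<open>{l 0..l N}\<close>\<close>

lemma equal_bins_grid:
  assumes "equal_bins l N \<Delta>" "j \<le> N"
  shows "l j = l 0 + real j * \<Delta>"
  using assms(2)
proof (induction j)
  case (Suc j)
  then have "l (Suc j) - l j = \<Delta>"
    using assms(1) unfolding equal_bins_def
    by (metis atLeastAtMost_iff diff_Suc_1 le_add1 plus_1_eq_Suc)
  then show ?case using Suc by (simp add: algebra_simps)
qed simp

lemma equal_bins_mono:
  assumes "equal_bins l N \<Delta>" "i \<le> j" "j \<le> N"
  shows "l i \<le> l j"
proof -
  have "real i * \<Delta> \<le> real j * \<Delta>"
    using assms by (intro mult_right_mono) (auto simp: equal_bins_def)
  then show ?thesis
    using assms equal_bins_grid[OF assms(1), of i] equal_bins_grid[OF assms(1), of j] by linarith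
qed

text \<open>Supplies a sample point at which identities between densities become identities between
  bin probabilities.\<close>

lemma left_endpoint_in_bin:
  assumes "equal_bins l N \<Delta>" "j \<in> {1..N}"
  shows "l (j - 1) \<in> bin l N j"
proof -
  have "l j - l (j - 1) = \<Delta>" "\<Delta> > 0"
    using assms unfolding equal_bins_def by blast+
  then show ?thesis by (simp add: bin_def)
qed

lemma bin_subset:
  assumes "equal_bins l N \<Delta>" "j \<in> {1..N}"
  shows "bin l N j \<subseteq> {l 0..l N}"
proof -
  have "l 0 \<le> l (j - 1)" "l j \<le> l N"
    using assms(2) by (auto intro!: equal_bins_mono[OF assms(1)])
  then show ?thesis by (auto simp: bin_def)
qed

lemma bin_unique:
  assumes b: "equal_bins l N \<Delta>" and "j \<in> {1..N}" "k \<in> {1..N}" "x \<in> bin l N j" "x \<in> bin l N k"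
  shows "j = k"
proof -
  have "\<not> j < k" if "j \<in> {1..N}" "k \<in> {1..N}" "x \<in> bin l N j" "x \<in> bin l N k" for j k
  proof
    assume "j < k"
    then have "l j \<le> l (k - 1)" using that by (intro equal_bins_mono[OF b]) auto
    \<comment> \<open>Since \<open>j < k \<le> N\<close>, bin \<open>j\<close> is half-open, so
      \<open>x < l j \<le> l (k - 1) \<le> x\<close>.\<close>
    then show False using that \<open>j < k\<close> by (auto simp: bin_def split: if_splits)
  qed
  then show ?thesis using assms(2-) by (meson linorder_neqE_nat)
qed

text \<open>Only the last bin contains its right end, so \<open>x = l N\<close> is treated apart;
  any other point lies in the bin ending at the first grid point beyond it.\<close>

lemma bin_exists:
  assumes b: "equal_bins l N \<Delta>" and x: "x \<in> {l 0..l N}"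
  obtains j where "j \<in> {1..N}" "x \<in> bin l N j"
proof (cases "x = l N")
  case True
  have "l (N - 1) \<le> l N" by (rule equal_bins_mono[OF b]) auto
  then show ?thesis using True b that[of N] by (auto simp: bin_def equal_bins_def)
next
  case False
  then have ex: "x < l N" using x by auto
  define j where "j = (LEAST j. x < l j)"
  have j: "x < l j" unfolding j_def using ex by (rule LeastI)
  have jN: "j \<le> N" unfolding j_def using ex by (rule Least_le)
  have j0: "j \<noteq> 0" using j x by (intro notI) auto
  then have "\<not> x < l (j - 1)" unfolding j_def by (intro not_less_Least) auto
  then have "x \<in> bin l N j" using j by (simp add: bin_def)
  then show ?thesis using jN j0 that[of j] by simp
qed

lemma indicator_bin:
  assumes "equal_bins l N \<Delta>" "j \<in> {1..N}" "k \<in> {1..N}" "x \<in> bin l N j"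
  shows "indicator (bin l N k) x = of_bool (k = j)"
proof (cases "k = j")
  case False
  then have "x \<notin> bin l N k" using bin_unique[OF assms(1-3)] assms(4) by blast
  then show ?thesis using False by simp
qed (simp add: assms)

text \<open>Stated over semirings because it serves twice: over the reals to evaluate densities,
  over \<open>ennreal\<close> to rewrite integrands.\<close>

lemma sum_bin_indicator:
  fixes c :: "nat \<Rightarrow> 'a::semiring_1"
  assumes "equal_bins l N \<Delta>" "j \<in> {1..N}" "x \<in> bin l N j"
  shows "(\<Sum>k=1..N. c k * indicator (bin l N k) x) = c j"
proof -
  have "(\<Sum>k=1..N. c k * indicator (bin l N k) x) = (\<Sum>k=1..N. if k = j then c k else 0)"
    by (rule sum.cong) (simp_all add: indicator_bin[OF assms(1,2) _ assms(3)])
  then show ?thesis using assms(2) by simp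
qed

lemma hist_density_bin:
  assumes "equal_bins l N \<Delta>" "j \<in> {1..N}" "x \<in> bin l N j"
  shows "hist_density l N \<Delta> p x = p j / \<Delta>"
  unfolding hist_density_def sum_divide_distrib[symmetric] sum_bin_indicator[OF assms] ..

section \<open>Integrals of functions that are constant on each bin\<close>

lemma emeasure_bin:
  assumes "equal_bins l N \<Delta>" "j \<in> {1..N}"
  shows "emeasure lborel (bin l N j) = ennreal \<Delta>"
proof -
  have "l j - l (j - 1) = \<Delta>" "\<Delta> > 0"
    using assms unfolding equal_bins_def by blast+
  then show ?thesis by (simp add: bin_def)
qed

text \<open>As the bins partition the interval, \<open>g\<close> cut off to it is a finite
  combination of bin indicators; measurability comes with that representation.\<close>

lemma nn_integral_step:
  fixes c :: "nat \<Rightarrow> ennreal"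
  assumes b: "equal_bins l N \<Delta>"
    and g: "\<And>j x. j \<in> {1..N} \<Longrightarrow> x \<in> bin l N j \<Longrightarrow> g x = c j"
  shows "(\<integral>\<^sup>+x\<in>{l 0..l N}. g x \<partial>lborel) = (\<Sum>j=1..N. c j * ennreal \<Delta>)"
proof -
  have [measurable]: "bin l N j \<in> sets borel" for j by (simp add: bin_def)
  have "g x * indicator {l 0..l N} x = (\<Sum>j=1..N. c j * indicator (bin l N j) x)" for x
  proof (cases "x \<in> {l 0..l N}")
    case True
    then obtain j where j: "j \<in> {1..N}" "x \<in> bin l N j" using bin_exists[OF b] by blast
    then show ?thesis using True g[OF j] unfolding sum_bin_indicator[OF b j] by simp
  next
    case False
    then have "x \<notin> bin l N j" if "j \<in> {1..N}" for j using bin_subset[OF b that] by blast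
    then show ?thesis using False by simp
  qed
  then have "(\<integral>\<^sup>+x\<in>{l 0..l N}. g x \<partial>lborel)
      = (\<integral>\<^sup>+x. (\<Sum>j=1..N. c j * indicator (bin l N j) x) \<partial>lborel)"
    by simp
  also have "\<dots> = (\<Sum>j=1..N. \<integral>\<^sup>+x. c j * indicator (bin l N j) x \<partial>lborel)"
    by (rule nn_integral_sum) measurable
  also have "\<dots> = (\<Sum>j=1..N. c j * ennreal \<Delta>)"
    using emeasure_bin[OF b] by (intro sum.cong) (simp_all add: nn_integral_cmult_indicator)
  finally show ?thesis .
qed

text \<open>Applied to \<open>c\<close> and to \<open>- c\<close>, this evaluates the two halves of
  \<open>ext_integral\<close>.\<close>

lemma enn2ereal_sum_e2ennreal:
  fixes c :: "nat \<Rightarrow> ereal"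
  assumes "\<Delta> > 0"
  shows "enn2ereal (\<Sum>j\<in>J. e2ennreal (c j) * ennreal \<Delta>) = (\<Sum>j\<in>J. max 0 (c j) * ereal \<Delta>)"
proof -
  have "enn2ereal (e2ennreal (c j)) = max 0 (c j)" for j
    by (cases "c j \<ge> 0") (simp_all add: enn2ereal_e2ennreal e2ennreal_neg zero_ennreal.rep_eq)
  then have "enn2ereal (e2ennreal (c j) * ennreal \<Delta>) = max 0 (c j) * ereal \<Delta>" for j
    using assms by (simp add: times_ennreal.rep_eq enn2ereal_ennreal)
  then show ?thesis by (subst sum_enn2ereal[symmetric]) auto
qed

text \<open>Without the value \<open>-\<infinity>\<close> the negative part is finite, so
  \<infinity> - \<infinity> cannot arise. The second equation serves the cross entropy, whose
  integrand may be \<open>-\<infinity>\<close> but not \<open>\<infinity>\<close>.\<close>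

lemma ext_integral_step:
  fixes c :: "nat \<Rightarrow> ereal"
  assumes b: "equal_bins l N \<Delta>"
    and f: "\<And>j x. j \<in> {1..N} \<Longrightarrow> x \<in> bin l N j \<Longrightarrow> f x = c j"
    and c: "\<And>j. j \<in> {1..N} \<Longrightarrow> c j \<noteq> -\<infinity>"
  shows "ext_integral {l 0..l N} f = (\<Sum>j=1..N. c j * ereal \<Delta>)"
    and "ext_integral {l 0..l N} (\<lambda>x. - f x) = - (\<Sum>j=1..N. c j * ereal \<Delta>)"
proof -
  have D: "\<Delta> > 0" using b by (simp add: equal_bins_def)
  have P: "enn2ereal (\<integral>\<^sup>+x\<in>{l 0..l N}. e2ennreal (f x) \<partial>lborel)
      = (\<Sum>j=1..N. max 0 (c j) * ereal \<Delta>)" (is "_ = ?P")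
    using nn_integral_step[OF b, of "\<lambda>x. e2ennreal (f x)" "\<lambda>j. e2ennreal (c j)"] f
      enn2ereal_sum_e2ennreal[OF D] by simp
  have Q: "enn2ereal (\<integral>\<^sup>+x\<in>{l 0..l N}. e2ennreal (- f x) \<partial>lborel)
      = (\<Sum>j=1..N. max 0 (- c j) * ereal \<Delta>)" (is "_ = ?Q")
    using nn_integral_step[OF b, of "\<lambda>x. e2ennreal (- f x)" "\<lambda>j. e2ennreal (- c j)"] f
      enn2ereal_sum_e2ennreal[OF D, of "\<lambda>j. - c j"] by simp
  have Qr: "?Q = ereal (\<Sum>j=1..N. max 0 (- real_of_ereal (c j)) * \<Delta>)"
  proof -
    \<comment> \<open>For \<open>c j = \<infinity>\<close> both sides are 0, because
      \<open>real_of_ereal\<close> is 0 there.\<close>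
    have "max 0 (- c j) * ereal \<Delta> = ereal (max 0 (- real_of_ereal (c j)) * \<Delta>)"
      if "j \<in> {1..N}" for j
      using c[OF that] by (cases "c j") (auto simp: max_def zero_ereal_def)
    then show ?thesis by (simp flip: sum_ereal)
  qed
  have diff: "?P - ?Q = (\<Sum>j=1..N. c j * ereal \<Delta>)"
  proof (cases "\<exists>j\<in>{1..N}. c j = \<infinity>")
    case True
    then obtain j where j: "j \<in> {1..N}" "c j = \<infinity>" by blast
    then have "?P = \<infinity>" "(\<Sum>j=1..N. c j * ereal \<Delta>) = \<infinity>"
      using D unfolding sum_Pinfty by (force intro!: bexI[of _ j])+
    then show ?thesis using Qr by simp
  next
    case False
    define r where "r j = real_of_ereal (c j)" for j
    have r: "c j = ereal (r j)" if "j \<in> {1..N}" for j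
      using False c that by (cases "c j") (auto simp: r_def)
    have "max 0 (c j) * ereal \<Delta> = ereal (max 0 (r j) * \<Delta>)" if "j \<in> {1..N}" for j
      using r[OF that] by (auto simp: max_def zero_ereal_def)
    then have P': "?P = ereal (\<Sum>j=1..N. max 0 (r j) * \<Delta>)" by (simp flip: sum_ereal)
    have "(\<Sum>j=1..N. c j * ereal \<Delta>) = ereal (\<Sum>j=1..N. r j * \<Delta>)"
      using r by (simp flip: sum_ereal)
    moreover have "(\<Sum>j=1..N. max 0 (r j) * \<Delta>) - (\<Sum>j=1..N. max 0 (- r j) * \<Delta>)
        = (\<Sum>j=1..N. r j * \<Delta>)"
      unfolding sum_subtractf[symmetric] by (intro sum.cong) (auto simp: max_def)
    ultimately show ?thesis unfolding P' Qr by (simp add: r_def)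
  qed
  show "ext_integral {l 0..l N} f = (\<Sum>j=1..N. c j * ereal \<Delta>)"
    unfolding ext_integral_def P Q by (rule diff)
  \<comment> \<open>Safe because \<open>?Q\<close> is real: in \<open>ereal\<close>, \<infinity> -
    \<infinity> is \<infinity>, which would break the rule.\<close>
  have "?Q - ?P = - (?P - ?Q)" unfolding Qr by (cases ?P) auto
  then show "ext_integral {l 0..l N} (\<lambda>x. - f x) = - (\<Sum>j=1..N. c j * ereal \<Delta>)"
    unfolding ext_integral_def ereal_uminus_uminus P Q diff by simp
qed

section \<open>Divergences between histogram densities as sums over bins\<close>

text \<open>The bin width cancels twice: in the ratio under the logarithm, and between the factor
  \<open>p j / \<Delta>\<close> and the length of the bin.\<close>

lemma KL_hist_density:
  assumes b: "equal_bins l N \<Delta>" and p: "hist_probs N p" and q: "hist_probs N q"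
  shows "KL {l 0..l N} (hist_density l N \<Delta> p) (hist_density l N \<Delta> q)
    = (\<Sum>j=1..N. if p j > 0 \<and> q j = 0 then \<infinity> else ereal (p j * ln (p j / q j)))"
proof -
  have D: "\<Delta> > 0" using b by (simp add: equal_bins_def)
  define c where "c j = ereal (p j / \<Delta>) * elog (ereal (p j / \<Delta>) / ereal (q j / \<Delta>))" for j
  have c: "c j = (if p j > 0 \<and> q j = 0 then \<infinity> else ereal (p j / \<Delta> * ln (p j / q j)))"
    if "j \<in> {1..N}" for j
  proof -
    have "p j \<ge> 0" "q j \<ge> 0" using p q that by (auto simp: hist_probs_def)
    \<comment> \<open>For \<open>p j = 0\<close> the logarithm is \<open>-\<infinity>\<close>, even
      if \<open>q j = 0\<close>, and its product with 0 is 0.\<close>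
    then consider "p j = 0" | "p j > 0" "q j = 0" | "p j > 0" "q j > 0" by fastforce
    then show ?thesis
    proof cases
      case 2
      then show ?thesis using D
        by (simp add: c_def elog_def zero_ereal_def[symmetric] divide_ereal_def)
    next
      case 3
      then show ?thesis using D by (simp add: c_def elog_def zero_ereal_def[symmetric])
          (simp add: not_le)
    qed (simp add: c_def zero_ereal_def[symmetric])
  qed
  have "KL {l 0..l N} (hist_density l N \<Delta> p) (hist_density l N \<Delta> q) = (\<Sum>j=1..N. c j * ereal \<Delta>)"
    unfolding KL_def
  proof (rule ext_integral_step(1)[OF b])
    fix j x assume "j \<in> {1..N}" "x \<in> bin l N j"
    then show "ereal (hist_density l N \<Delta> p x) *
        elog (ereal (hist_density l N \<Delta> p x) / ereal (hist_density l N \<Delta> q x)) = c j"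
      by (simp only: hist_density_bin[OF b] c_def)
  qed (simp add: c)
  also have "\<dots> = (\<Sum>j=1..N. if p j > 0 \<and> q j = 0 then \<infinity> else ereal (p j * ln (p j / q j)))"
    using D by (intro sum.cong) (auto simp: c)
  finally show ?thesis .
qed

text \<open>Here \<open>\<Delta>\<close> survives under the logarithm, which contains no ratio of
  densities; it later contributes a multiple of \<open>ln \<Delta>\<close> to the additive
  constant.\<close>

lemma cross_entropy_hist_density:
  assumes b: "equal_bins l N \<Delta>" and p: "hist_probs N p" and q: "hist_probs N q"
  shows "cross_entropy {l 0..l N} (hist_density l N \<Delta> p) (hist_density l N \<Delta> q)
    = (\<Sum>j=1..N. if p j > 0 \<and> q j = 0 then \<infinity> else ereal (- p j * ln (q j / \<Delta>)))"
proof -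
  have D: "\<Delta> > 0" using b by (simp add: equal_bins_def)
  define c where "c j = - (ereal (p j / \<Delta>) * elog (ereal (q j / \<Delta>)))" for j
  have c: "c j = (if p j > 0 \<and> q j = 0 then \<infinity> else ereal (- p j / \<Delta> * ln (q j / \<Delta>)))"
    if "j \<in> {1..N}" for j
  proof -
    have "p j \<ge> 0" "q j \<ge> 0" using p q that by (auto simp: hist_probs_def)
    then consider "p j = 0" | "p j > 0" "q j = 0" | "p j > 0" "q j > 0" by fastforce
    then show ?thesis using D
      by cases (simp_all add: c_def elog_def zero_ereal_def[symmetric], simp_all add: not_le)
  qed
  \<comment> \<open>The double negation shows the integrand as minus a function whose bin values
    avoid \<open>-\<infinity>\<close>, the form of \<open>ext_integral_step(2)\<close>.\<close>
  have "ext_integral {l 0..l N}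
      (\<lambda>x. - (- (ereal (hist_density l N \<Delta> p x) * elog (ereal (hist_density l N \<Delta> q x)))))
    = - (\<Sum>j=1..N. c j * ereal \<Delta>)"
  proof (rule ext_integral_step(2)[OF b])
    fix j x assume "j \<in> {1..N}" "x \<in> bin l N j"
    then show "- (ereal (hist_density l N \<Delta> p x) * elog (ereal (hist_density l N \<Delta> q x))) = c j"
      by (simp only: hist_density_bin[OF b] c_def)
  qed (simp add: c)
  then have "cross_entropy {l 0..l N} (hist_density l N \<Delta> p) (hist_density l N \<Delta> q)
      = (\<Sum>j=1..N. c j * ereal \<Delta>)"
    by (simp add: cross_entropy_def)
  also have "\<dots> = (\<Sum>j=1..N. if p j > 0 \<and> q j = 0 then \<infinity> else ereal (- p j * ln (q j / \<Delta>)))"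
    using D by (intro sum.cong) (auto simp: c)
  finally show ?thesis .
qed

section \<open>The loss of one sample with a decomposed target\<close>

lemma hist_probs_decomposition:
  assumes b: "equal_bins l N \<Delta>" and j: "j \<in> {1..N}" and e: "e \<in> {1..N}"
    and dec: "\<And>x. hist_density l N \<Delta> p x =
      (1 - \<epsilon>) * (indicator (bin l N e) x / \<Delta>) + \<epsilon> * hist_density l N \<Delta> \<mu> x"
  shows "p j = (1 - \<epsilon>) * of_bool (j = e) + \<epsilon> * \<mu> j"
proof -
  have D: "\<Delta> > 0" using b by (simp add: equal_bins_def)
  note x = left_endpoint_in_bin[OF b j]
  have "indicator (bin l N e) (l (j - 1)) = (of_bool (j = e) :: real)"
    using indicator_bin[OF b j e x] by (simp add: eq_commute)
  then have "p j / \<Delta> = (1 - \<epsilon>) * (of_bool (j = e) / \<Delta>) + \<epsilon> * (\<mu> j / \<Delta>)"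
    using dec[of "l (j - 1)"] hist_density_bin[OF b j x] by simp
  then have "p j / \<Delta> * \<Delta> = ((1 - \<epsilon>) * of_bool (j = e) + \<epsilon> * \<mu> j) / \<Delta> * \<Delta>"
    by (simp add: add_divide_distrib)
  then show ?thesis using D by simp
qed

text \<open>Each summand is real or \<open>\<infinity>\<close>. Hence the regularised loss of a
  sample is never \<open>-\<infinity>\<close>, as \<open>ereal_mean_affine\<close> demands.\<close>

lemma cross_entropy_hist_density_not_MInf:
  assumes "equal_bins l N \<Delta>" "hist_probs N p" "hist_probs N q"
  shows "cross_entropy {l 0..l N} (hist_density l N \<Delta> p) (hist_density l N \<Delta> q) \<noteq> -\<infinity>"
proof -
  have "sum f {1..N} \<noteq> -\<infinity>" if "\<And>j. f j \<noteq> -\<infinity>" for f :: "nat \<Rightarrow> ereal"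
    using that by (induction N) (auto simp: ereal_plus_eq_MInfty)
  then show ?thesis unfolding cross_entropy_hist_density[OF assms] by simp
qed

text \<open>The part of the divergence that involves \<open>q\<close> is linear in \<open>p\<close>,
  so it splits along the decomposition. The constant is the negative entropy of \<open>p\<close>,
  less \<open>\<epsilon> * ln \<Delta>\<close> to offset the density scaling in the cross
  entropy.\<close>

lemma KL_decomposed_target:
  assumes b: "equal_bins l N \<Delta>" and p: "hist_probs N p" and q: "hist_probs N q"
    and \<mu>: "hist_probs N \<mu>" and e: "e \<in> {1..N}" and \<epsilon>: "0 < \<epsilon>" "\<epsilon> < 1"
    and dec: "\<And>x. hist_density l N \<Delta> p x =
      (1 - \<epsilon>) * (indicator (bin l N e) x / \<Delta>) + \<epsilon> * hist_density l N \<Delta> \<mu> x"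
  shows "KL {l 0..l N} (hist_density l N \<Delta> p) (hist_density l N \<Delta> q)
    = ereal (1 - \<epsilon>) * (- elog (ereal (q e)) + ereal (\<epsilon> / (1 - \<epsilon>)) *
        cross_entropy {l 0..l N} (hist_density l N \<Delta> \<mu>) (hist_density l N \<Delta> q))
      + ereal ((\<Sum>j=1..N. p j * ln (p j)) - \<epsilon> * ln \<Delta>)"
    (is "?KL = ereal (1 - \<epsilon>) * (- ?L + ereal ?\<alpha> * ?H) + ereal ?C")
proof -
  have D: "\<Delta> > 0" using b by (simp add: equal_bins_def)
  have \<alpha>: "?\<alpha> > 0" using \<epsilon> by simp
  note pj = hist_probs_decomposition[OF b _ e dec]
  have nonneg: "q j \<ge> 0" "\<mu> j \<ge> 0" "p j \<ge> 0" if "j \<in> {1..N}" for j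
    using p q \<mu> that by (auto simp: hist_probs_def)
  \<comment> \<open>The support of the target is that of \<open>\<mu>\<close> together with
    \<open>e\<close>, by \<open>\<epsilon> > 0\<close> and \<open>\<epsilon> < 1\<close>; this
    matches the infinite cases of the two losses.\<close>
  have pos: "p j > 0 \<longleftrightarrow> j = e \<or> \<mu> j > 0" if "j \<in> {1..N}" for j
    using pj[OF that] nonneg(2)[OF that] \<epsilon> by (auto simp: add_pos_nonneg zero_less_mult_iff)
  note KL = KL_hist_density[OF b p q] and H = cross_entropy_hist_density[OF b \<mu> q]
  note H_MInf = cross_entropy_hist_density_not_MInf[OF b \<mu> q]
  have L: "- ?L = (if q e = 0 then \<infinity> else ereal (- ln (q e)))"
    using nonneg(1)[OF e] by (auto simp: elog_def zero_ereal_def[symmetric])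
  show ?thesis
  proof (cases "\<exists>j\<in>{1..N}. p j > 0 \<and> q j = 0")
    case True
    then have "?KL = \<infinity>" unfolding KL by (auto simp: sum_Pinfty)
    \<comment> \<open>A bin where \<open>q\<close> misses the target is either \<open>e\<close>,
      making the log term infinite, or charged by \<open>\<mu>\<close>, making the cross entropy
      infinite.\<close>
    moreover have "- ?L = \<infinity> \<or> ?H = \<infinity>"
      using True pos unfolding L H sum_Pinfty by auto
    then have "- ?L + ereal ?\<alpha> * ?H = \<infinity>"
      using \<alpha> H_MInf L by (cases ?H) auto
    ultimately show ?thesis using \<epsilon> by simp
  next
    case False
    then have qpos: "q j > 0" if "j \<in> {1..N}" "p j > 0" for j
      using nonneg(1)[OF that(1)] that by (metis less_eq_real_def)
    have qe: "q e > 0" using qpos[OF e] pos[OF e] by simp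
    have KLr: "?KL = ereal (\<Sum>j=1..N. p j * ln (p j / q j))"
      unfolding KL sum_ereal[symmetric] using False by (intro sum.cong) auto
    have "?H = ereal (\<Sum>j=1..N. - \<mu> j * ln (q j / \<Delta>))"
      unfolding H sum_ereal[symmetric] using False pos by (intro sum.cong) auto
    also have "(\<Sum>j=1..N. - \<mu> j * ln (q j / \<Delta>)) = (\<Sum>j=1..N. \<mu> j * ln \<Delta> - \<mu> j * ln (q j))"
    proof (intro sum.cong refl)
      fix j assume j: "j \<in> {1..N}"
      show "- \<mu> j * ln (q j / \<Delta>) = \<mu> j * ln \<Delta> - \<mu> j * ln (q j)"
      \<comment> \<open>Where \<open>\<mu> j = 0\<close>, \<open>q j\<close> may vanish and
        \<open>ln_div\<close> may fail to apply, but both sides are 0.\<close>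
      proof (cases "\<mu> j = 0")
        case False
        then have "q j > 0" using qpos[OF j] pos[OF j] nonneg(2)[OF j] by simp
        then show ?thesis using D by (simp add: ln_div algebra_simps)
      qed simp
    qed
    \<comment> \<open>The total mass 1 of \<open>\<mu>\<close> collapses the first part to
      \<open>ln \<Delta>\<close>.\<close>
    also have "\<dots> = ln \<Delta> - (\<Sum>j=1..N. \<mu> j * ln (q j))"
      using \<mu> by (simp add: sum_subtractf hist_probs_def flip: sum_distrib_right)
    finally have Hr: "?H = ereal (ln \<Delta> - (\<Sum>j=1..N. \<mu> j * ln (q j)))" .
    have "(\<Sum>j=1..N. p j * ln (p j / q j))
        = (\<Sum>j=1..N. p j * ln (p j) - (if j = e then (1 - \<epsilon>) * ln (q j) else 0)
            - \<epsilon> * (\<mu> j * ln (q j)))"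
    proof (intro sum.cong refl)
      fix j assume j: "j \<in> {1..N}"
      have "p j * ln (p j / q j) = p j * ln (p j) - p j * ln (q j)"
        using qpos[OF j] nonneg(3)[OF j] by (cases "p j = 0") (auto simp: ln_div algebra_simps)
      moreover have "p j * ln (q j)
          = (if j = e then (1 - \<epsilon>) * ln (q j) else 0) + \<epsilon> * (\<mu> j * ln (q j))"
        unfolding pj[OF j] by (simp add: algebra_simps)
      ultimately show "p j * ln (p j / q j) = p j * ln (p j)
          - (if j = e then (1 - \<epsilon>) * ln (q j) else 0) - \<epsilon> * (\<mu> j * ln (q j))"
        by simp
    qed
    also have "\<dots> = (\<Sum>j=1..N. p j * ln (p j)) - (1 - \<epsilon>) * ln (q e)
        - \<epsilon> * (\<Sum>j=1..N. \<mu> j * ln (q j))"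
      using e by (simp add: sum_subtractf sum_distrib_left)
    finally have K: "(\<Sum>j=1..N. p j * ln (p j / q j)) = (\<Sum>j=1..N. p j * ln (p j))
        - (1 - \<epsilon>) * ln (q e) - \<epsilon> * (\<Sum>j=1..N. \<mu> j * ln (q j))" .
    \<comment> \<open>The reason for the value of \<open>?\<alpha>\<close>: factoring out the weight
      \<open>1 - \<epsilon>\<close> of bin \<open>e\<close> leaves
      \<open>\<epsilon> / (1 - \<epsilon>)\<close> on the other term.\<close>
    have "(1 - \<epsilon>) * (u + ?\<alpha> * v) = (1 - \<epsilon>) * u + \<epsilon> * v" for u v
      using \<epsilon> by (simp add: distrib_left)
    then show ?thesis
      unfolding KLr Hr L K using qe \<epsilon> by (simp add: right_diff_distrib)
  qed
qed

theorem proposition2: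
  fixes l :: "nat \<Rightarrow> real" and N :: nat and \<Delta> :: real
    and n :: nat and s s' :: "nat \<Rightarrow> 's" and a :: "nat \<Rightarrow> 'a"
    and M :: "'w measure" and R :: "'s \<Rightarrow> 'a \<Rightarrow> 'w \<Rightarrow> real" and \<gamma> :: real
    and \<Theta> :: "'p set" and \<theta>_target :: 'p
    and Z :: "'p \<Rightarrow> 's \<Rightarrow> 'a \<Rightarrow> 'w \<Rightarrow> real" and q :: "'p \<Rightarrow> 's \<Rightarrow> 'a \<Rightarrow> nat \<Rightarrow> real"
    and \<pi>\<^sub>Z :: "'s \<Rightarrow> 'a" and Y :: "nat \<Rightarrow> 'w \<Rightarrow> real"
    and hist :: "real measure \<Rightarrow> nat \<Rightarrow> real" and p \<mu> :: "nat \<Rightarrow> nat \<Rightarrow> real"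
    and E :: "nat \<Rightarrow> nat" and \<epsilon> \<alpha> :: real
  assumes bins: "equal_bins l N \<Delta>"
    and n: "n \<ge> 1"
    and M: "prob_space M"
    \<comment> \<open>the network: \<open>Z\<^sub>\<theta>(s,a)\<close> has a histogram density with bin probabilities \<open>q \<theta> s a\<close>\<close>
    and q: "\<And>\<theta> s a. \<theta> \<in> \<Theta> \<Longrightarrow> hist_probs N (q \<theta> s a)"
    and Z: "\<And>\<theta> s a. \<theta> \<in> \<Theta> \<Longrightarrow>
              distributed M lborel (Z \<theta> s a) (\<lambda>x. ennreal (hist_density l N \<Delta> (q \<theta> s a) x))"
    \<comment> \<open>the target returns\<close>
    and \<theta>_target: "\<theta>_target \<in> \<Theta>"
    and policy: "\<And>i. i \<in> {1..n} \<Longrightarrow>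
              is_arg_max (\<lambda>a'. prob_space.expectation M (Z \<theta>_target (s' i) a')) (\<lambda>_. True) (\<pi>\<^sub>Z (s' i))"
    and R: "\<And>i. i \<in> {1..n} \<Longrightarrow> integrable M (R (s i) (a i))"
    and Y: "\<And>i \<omega>. Y i \<omega> = R (s i) (a i) \<omega> + \<gamma> * Z \<theta>_target (s' i) (\<pi>\<^sub>Z (s' i)) \<omega>"
    \<comment> \<open>\<open>hist\<close> is any scheme that represents the laws of the target returns by histograms\<close>
    and p: "\<And>i. i \<in> {1..n} \<Longrightarrow> p i = hist (distr M borel (Y i)) \<and> hist_probs N (p i)"
    and E: "\<And>i. i \<in> {1..n} \<Longrightarrow>
              E i \<in> {1..N} \<and> prob_space.expectation M (Y i) \<in> bin l N (E i)"
    \<comment> \<open>the decomposition of the target densities\<close>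
    and \<epsilon>: "0 < \<epsilon>" "\<epsilon> < 1"
    and \<mu>: "\<And>i. i \<in> {1..n} \<Longrightarrow> hist_probs N (\<mu> i)"
    and decomposition: "\<And>i x. i \<in> {1..n} \<Longrightarrow>
              hist_density l N \<Delta> (p i) x =
                (1 - \<epsilon>) * (indicator (bin l N (E i)) x / \<Delta>) + \<epsilon> * hist_density l N \<Delta> (\<mu> i) x"
    and \<alpha>: "\<alpha> = \<epsilon> / (1 - \<epsilon>)"
  shows "\<alpha> > 0 \<and>
    neural_FZI_update
      (\<lambda>p q. KL {l 0..l N} (hist_density l N \<Delta> p) (hist_density l N \<Delta> q)) n s a p (q ` \<Theta>)
    = argmin_set
        (\<lambda>q. ereal (1 / real n) * (\<Sum>i=1..n.
            - elog (ereal (q (s i) (a i) (E i)))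
            + ereal \<alpha> * cross_entropy {l 0..l N}
                (hist_density l N \<Delta> (\<mu> i)) (hist_density l N \<Delta> (q (s i) (a i)))))
        (q ` \<Theta>)"
proof -
  have \<alpha>_pos: "\<alpha> > 0" using \<epsilon> \<alpha> by simp
  let ?G = "\<lambda>q i. - elog (ereal (q (s i) (a i) (E i)))
    + ereal \<alpha> * cross_entropy {l 0..l N}
        (hist_density l N \<Delta> (\<mu> i)) (hist_density l N \<Delta> (q (s i) (a i)))"
  \<comment> \<open>The offset depends on targets and bins only, not on the candidate
    \<open>Q\<close>, so averaging gives one constant shift for the whole class.\<close>
  let ?C = "\<lambda>i. (\<Sum>j=1..N. p i j * ln (p i j)) - \<epsilon> * ln \<Delta>"
  have "ereal (1 / real n) * (\<Sum>i=1..n.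
        KL {l 0..l N} (hist_density l N \<Delta> (p i)) (hist_density l N \<Delta> (Q (s i) (a i))))
      = ereal (1 - \<epsilon>) * (ereal (1 / real n) * (\<Sum>i=1..n. ?G Q i))
        + ereal (1 / real n * (\<Sum>i=1..n. ?C i))" if "Q \<in> q ` \<Theta>" for Q
  proof (rule ereal_mean_affine)
    fix i assume i: "i \<in> {1..n}"
    have Q: "hist_probs N (Q (s i) (a i))" using that q by auto
    show "KL {l 0..l N} (hist_density l N \<Delta> (p i)) (hist_density l N \<Delta> (Q (s i) (a i)))
        = ereal (1 - \<epsilon>) * ?G Q i + ereal (?C i)"
      unfolding \<alpha> using p[OF i] E[OF i] \<mu>[OF i] \<epsilon> decomposition[OF i]
      by (intro KL_decomposed_target[OF bins _ Q]) auto
    have "- elog (ereal (Q (s i) (a i) (E i))) \<noteq> -\<infinity>"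
      by (simp add: elog_def)
    then show "?G Q i \<noteq> -\<infinity>"
      using cross_entropy_hist_density_not_MInf[OF bins \<mu>[OF i] Q] \<alpha>_pos
      by (auto simp: ereal_plus_eq_MInfty)
  qed (use \<epsilon> n in auto)
  then show ?thesis
    unfolding neural_FZI_update_def using \<alpha>_pos \<epsilon>
    by (intro conjI argmin_set_cong_affine[where c = "1 - \<epsilon>"]) auto
qed

end
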